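(* For a positive integer $n$, the $n\times n$ matrix $\mathfrak B=[\mathfrak w(i+j)]_{i,j=0}^{n-1}$ is infinitely divisible if and only if $n\le 4$.
   Context: Here $\mathfrak w(m)$ is the $m$th Bell number: $\mathfrak w(m)=\sum_{k=0}^{m}S(m,k)$ is the number of partitions of a set of $m$ objects, where $S(m,k)$ are the Stirling numbers of second kind (so $\mathfrak w(0)=1$). A complex $n\times n$ matrix $A$ is positive semidefinite if $x^*Ax\ge 0$ for all $x\in\mathbb C^n$. An $n\times n$ matrix $A=[a_{ij}]$ with $a_{ij}\ge 0$ is called infinitely divisible if the entrywise power $A^{\circ r}=[a_{ij}^r]$ is positive semidefinite for every real $r>0$. *)

theory Defs
  imports
    Complex_Main
    "HOL-Combinatorics.Stirling"
    "Jordan_Normal_Form.Matrix"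
begin

definition bell :: "nat \<Rightarrow> nat" where
  "bell m = (\<Sum>k\<le>m. Stirling m k)"

text \<open>
  The inner product conjugates its second argument, so the expression below is \<open>x\<^sup>* A x\<close>.
  In the order on the complex numbers, \<open>0 \<le> z\<close> means that \<open>z\<close> is real and nonnegative.
\<close>

definition positive_semidefinite :: "complex mat \<Rightarrow> bool" where
  "positive_semidefinite A \<longleftrightarrow> square_mat A \<and>
     (\<forall>x \<in> carrier_vec (dim_row A). 0 \<le> (A *\<^sub>v x) \<bullet>c x)"

text \<open>Used with nonnegative entries and \<open>r > 0\<close> only; there \<open>0 powr r = 0\<close> is the usual value.\<close>

definition entrywise_power :: "real mat \<Rightarrow> real \<Rightarrow> real mat" where
  "entrywise_power A r = map_mat (\<lambda>a. a powr r) A"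

definition infinitely_divisible :: "real mat \<Rightarrow> bool" where
  "infinitely_divisible A \<longleftrightarrow> square_mat A \<and>
     (\<forall>i < dim_row A. \<forall>j < dim_col A. 0 \<le> A $$ (i, j)) \<and>
     (\<forall>r > 0. positive_semidefinite (map_mat complex_of_real (entrywise_power A r)))"

definition bell_matrix :: "nat \<Rightarrow> real mat" where
  "bell_matrix n = mat n n (\<lambda>(i, j). real (bell (i + j)))"

end

theory Submission
  imports "HOL-Analysis.Harmonic_Numbers" Defs
begin

unbundle no vec_syntax

text \<open>
  Write \<open>L k = ln (bell k)\<close>, so that the entrywise \<open>r\<close>-th power of the Bell matrix has the entries
  \<open>exp (r * L (i + j))\<close>. Infinite divisibility is decided by the second differences
  \<open>d k = L k - 2 * L (k + 1) + L (k + 2)\<close>.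

  Summing twice gives \<open>L (i + j) = L i + L j - L 0 + (\<Sum>k<i. \<Sum>l<j. d (k + l))\<close>. If the Hankel matrix
  \<open>d (k + l)\<close> of size \<open>n - 1\<close> is a nonnegative combination of rank-one matrices, then so is the
  double sum, and the terms that depend on \<open>i\<close> or \<open>j\<close> alone only rescale the variables of the
  quadratic form. Entrywise powers of such a matrix with natural exponents are positive semidefinite,
  hence so is its entrywise exponential (\<open>nonneg_form_powr_hankel\<close>). For \<open>n = 4\<close> the Hankel matrix
  of \<open>d\<close> is 3 by 3, its leading minors are positive, and elimination writes it as the required
  combination (\<open>bell_log_second_differences_gram\<close>). Smaller \<open>n\<close> give leading submatrices.

  For \<open>n \<ge> 5\<close>, evaluate the form on \<open>x = (0, -1, 3, -3, 1)\<close>, the third difference at index 1.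
  Since the entries of \<open>x\<close> sum to 0, the value vanishes as \<open>r\<close> tends to 0, and its derivative at
  \<open>r = 0\<close> is the sixth difference of \<open>L\<close> at index 2. This number is negative, which amounts to an
  inequality between two integers (\<open>bell_log_sixth_difference_neg\<close>); so the form is negative for
  all small \<open>r > 0\<close>.
\<close>

section \<open>Nonnegative quadratic forms\<close>

text \<open>
  Matrices are functions of two indices here, so that leading submatrices of one and the same
  infinite Hankel matrix can be compared without changing the object.
\<close>
definition nonneg_form :: "nat \<Rightarrow> (nat \<Rightarrow> nat \<Rightarrow> real) \<Rightarrow> bool" where
  "nonneg_form n K \<longleftrightarrow> (\<forall>x. 0 \<le> (\<Sum>i<n. \<Sum>j<n. K i j * x i * x j))"

lemma nonneg_form_mono:
  assumes "nonneg_form n K" "m \<le> n"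
  shows "nonneg_form m K"
  unfolding nonneg_form_def
proof
  fix x :: "nat \<Rightarrow> real"
  define y where "y i = (if i < m then x i else 0)" for i
  have "0 \<le> (\<Sum>i<n. \<Sum>j<n. K i j * y i * y j)"
    using assms(1) by (simp add: nonneg_form_def)
  also have "\<dots> = (\<Sum>i<m. \<Sum>j<n. K i j * y i * y j)"
    by (rule sum.mono_neutral_right) (use assms(2) in \<open>auto simp: y_def\<close>)
  also have "\<dots> = (\<Sum>i<m. \<Sum>j<m. K i j * y i * y j)"
    by (intro sum.cong refl sum.mono_neutral_right) (use assms(2) in \<open>auto simp: y_def\<close>)
  also have "\<dots> = (\<Sum>i<m. \<Sum>j<m. K i j * x i * x j)"
    by (intro sum.cong refl) (auto simp: y_def)
  finally show "0 \<le> (\<Sum>i<m. \<Sum>j<m. K i j * x i * x j)" .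
qed

text \<open>
  For a real symmetric matrix, the Hermitian form at \<open>z\<close> is the sum of the real form at the real
  part and at the imaginary part of \<open>z\<close>; the mixed terms cancel by symmetry.
\<close>
lemma positive_semidefinite_of_real_iff:
  fixes K :: "nat \<Rightarrow> nat \<Rightarrow> real"
  assumes sym: "\<And>i j. K i j = K j i"
  shows "positive_semidefinite (map_mat complex_of_real (mat n n (\<lambda>(i, j). K i j)))
           \<longleftrightarrow> nonneg_form n K"
proof -
  define A where "A = map_mat complex_of_real (mat n n (\<lambda>(i, j). K i j))"
  have A: "A \<in> carrier_mat n n" by (simp add: A_def)
  define Q where "Q x = (\<Sum>i<n. \<Sum>j<n. K i j * x i * x j)" for x
  have form: "(A *\<^sub>v z) \<bullet>c z
      = complex_of_real (Q (\<lambda>i. Re (z $ i)) + Q (\<lambda>i. Im (z $ i)))"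
    if z: "z \<in> carrier_vec n" for z
  proof -
    have *: "(A *\<^sub>v z) \<bullet>c z
        = (\<Sum>i<n. \<Sum>j<n. complex_of_real (K i j) * z $ j * cnj (z $ i))"
      using z A
      by (simp add: scalar_prod_def A_def atLeast0LessThan sum_distrib_right)
    have skew: "(\<Sum>i<n. \<Sum>j<n. K i j * (Im (z $ j) * Re (z $ i)))
        = (\<Sum>i<n. \<Sum>j<n. K i j * (Re (z $ j) * Im (z $ i)))"
      by (subst sum.swap) (simp add: sym mult_ac)
    show ?thesis
      unfolding *
    proof (rule complex_eqI)
      show "Re (\<Sum>i<n. \<Sum>j<n. complex_of_real (K i j) * z $ j * cnj (z $ i))
          = Re (complex_of_real (Q (\<lambda>i. Re (z $ i)) + Q (\<lambda>i. Im (z $ i))))"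
        by (simp add: Q_def sum.distrib [symmetric] algebra_simps)
      show "Im (\<Sum>i<n. \<Sum>j<n. complex_of_real (K i j) * z $ j * cnj (z $ i))
          = Im (complex_of_real (Q (\<lambda>i. Re (z $ i)) + Q (\<lambda>i. Im (z $ i))))"
        using skew by (simp add: sum_subtractf algebra_simps)
    qed
  qed
  show ?thesis
    unfolding A_def [symmetric]
  proof
    assume psd: "positive_semidefinite A"
    show "nonneg_form n K"
      unfolding nonneg_form_def Q_def [symmetric]
    proof
      fix x :: "nat \<Rightarrow> real"
      define z where "z = vec n (\<lambda>i. complex_of_real (x i))"
      have z: "z \<in> carrier_vec n" by (simp add: z_def)
      have "Q (\<lambda>i. Re (z $ i)) = Q x" "Q (\<lambda>i. Im (z $ i)) = 0"
        unfolding Q_def by (auto simp: z_def intro!: sum.cong)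
      moreover have "0 \<le> (A *\<^sub>v z) \<bullet>c z"
        using psd A z by (auto simp: positive_semidefinite_def)
      ultimately show "0 \<le> Q x"
        by (simp add: form [OF z] less_eq_complex_def)
    qed
  next
    assume "nonneg_form n K"
    hence "0 \<le> Q x" for x by (simp add: nonneg_form_def Q_def)
    thus "positive_semidefinite A"
      using A by (auto simp: positive_semidefinite_def form less_eq_complex_def)
  qed
qed

lemma infinitely_divisible_bell_matrix_iff:
  "infinitely_divisible (bell_matrix n) \<longleftrightarrow>
     (\<forall>r>0. nonneg_form n (\<lambda>i j. real (bell (i + j)) powr r))"
proof -
  have "map_mat complex_of_real (entrywise_power (bell_matrix n) r)
      = map_mat complex_of_real (mat n n (\<lambda>(i, j). real (bell (i + j)) powr r))" for r
    by (rule eq_matI) (auto simp: entrywise_power_def bell_matrix_def)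
  hence "positive_semidefinite (map_mat complex_of_real (entrywise_power (bell_matrix n) r))
      \<longleftrightarrow> nonneg_form n (\<lambda>i j. real (bell (i + j)) powr r)" for r
    using positive_semidefinite_of_real_iff [of "\<lambda>i j. real (bell (i + j)) powr r"]
    by (simp add: add.commute)
  thus ?thesis
    by (simp add: infinitely_divisible_def bell_matrix_def)
qed

section \<open>Entrywise products and exponentials\<close>

text \<open>
  The Schur product theorem with one factor given as a combination of rank-one matrices.
  Multiplying \<open>H\<close> entrywise by \<open>u l i * u l j\<close> replaces the variable \<open>x i\<close> by \<open>u l i * x i\<close>, so the
  form of the product is a nonnegative combination of values of the form of \<open>H\<close>.
\<close>
lemma nonneg_form_gram_mult:
  fixes c :: "nat \<Rightarrow> real" and u :: "nat \<Rightarrow> nat \<Rightarrow> real"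
  assumes H: "nonneg_form n H" and c: "\<And>l. l < m \<Longrightarrow> 0 \<le> c l"
  shows "nonneg_form n (\<lambda>i j. (\<Sum>l<m. c l * u l i * u l j) * H i j)"
  unfolding nonneg_form_def
proof
  fix x :: "nat \<Rightarrow> real"
  have "(\<Sum>i<n. \<Sum>j<n. (\<Sum>l<m. c l * u l i * u l j) * H i j * x i * x j)
      = (\<Sum>i<n. \<Sum>j<n. \<Sum>l<m. c l * (H i j * (u l i * x i) * (u l j * x j)))"
    by (simp add: sum_distrib_right sum_distrib_left mult_ac)
  also have "\<dots> = (\<Sum>i<n. \<Sum>l<m. \<Sum>j<n. c l * (H i j * (u l i * x i) * (u l j * x j)))"
    by (intro sum.cong refl sum.swap)
  also have "\<dots> = (\<Sum>l<m. \<Sum>i<n. \<Sum>j<n. c l * (H i j * (u l i * x i) * (u l j * x j)))"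
    by (rule sum.swap)
  also have "\<dots> = (\<Sum>l<m. c l * (\<Sum>i<n. \<Sum>j<n. H i j * (u l i * x i) * (u l j * x j)))"
    by (simp add: sum_distrib_left)
  also have "\<dots> \<ge> 0"
    by (rule sum_nonneg, rule mult_nonneg_nonneg [OF c])
      (use H in \<open>simp_all add: nonneg_form_def\<close>)
  finally show "0 \<le> (\<Sum>i<n. \<Sum>j<n. (\<Sum>l<m. c l * u l i * u l j) * H i j * x i * x j)" .
qed

text \<open>
  Every entrywise power is a nonnegative form, starting from the all-ones matrix for the exponent
  0, and the exponential series has positive coefficients.
\<close>
lemma nonneg_form_exp_gram:
  fixes c :: "nat \<Rightarrow> real" and u :: "nat \<Rightarrow> nat \<Rightarrow> real"
  assumes c: "\<And>l. l < m \<Longrightarrow> 0 \<le> c l"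
  shows "nonneg_form n (\<lambda>i j. exp (\<Sum>l<m. c l * u l i * u l j))"
  unfolding nonneg_form_def
proof
  fix x :: "nat \<Rightarrow> real"
  define G where "G i j = (\<Sum>l<m. c l * u l i * u l j)" for i j
  have pow: "nonneg_form n (\<lambda>i j. G i j ^ k)" for k
  proof (induction k)
    case 0
    have "(\<Sum>i<n. \<Sum>j<n. x i * x j) = (\<Sum>i<n. x i)\<^sup>2" for x :: "nat \<Rightarrow> real"
      by (simp add: power2_eq_square sum_product)
    thus ?case by (simp add: nonneg_form_def)
  next
    case (Suc k)
    from nonneg_form_gram_mult [OF this c, where u = u] show ?case
      by (simp add: G_def)
  qed
  have sums: "(\<lambda>k. \<Sum>i<n. \<Sum>j<n. (G i j ^ k /\<^sub>R fact k) * x i * x j)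
      sums (\<Sum>i<n. \<Sum>j<n. exp (G i j) * x i * x j)"
    by (intro sums_sum sums_mult2 exp_converges)
  have nonneg: "0 \<le> (\<Sum>i<n. \<Sum>j<n. (G i j ^ k /\<^sub>R fact k) * x i * x j)" for k
  proof -
    have "(\<Sum>i<n. \<Sum>j<n. (G i j ^ k /\<^sub>R fact k) * x i * x j)
        = (\<Sum>i<n. \<Sum>j<n. G i j ^ k * x i * x j) / fact k"
      by (simp add: sum_divide_distrib divide_inverse sum_distrib_left mult_ac)
    also have "\<dots> \<ge> 0"
      using pow [of k] by (simp add: nonneg_form_def)
    finally show ?thesis .
  qed
  from sums_le [OF nonneg sums_zero sums]
  show "0 \<le> (\<Sum>i<n. \<Sum>j<n. exp (\<Sum>l<m. c l * u l i * u l j) * x i * x j)"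
    by (simp only: G_def)
qed

section \<open>Hankel matrices with positive entries\<close>

lemma sum_second_differences:
  fixes L :: "nat \<Rightarrow> real"
  shows "(\<Sum>k<i. \<Sum>l<j. L (k + l) - 2 * L (k + l + 1) + L (k + l + 2))
           = L (i + j) - L i - L j + L 0"
proof -
  have "(\<Sum>l<j. L (k + l) - 2 * L (k + l + 1) + L (k + l + 2))
      = (L (Suc k + j) - L (k + j)) - (L (Suc k) - L k)" for k
    by (induction j) (simp_all add: algebra_simps)
  hence "(\<Sum>k<i. \<Sum>l<j. L (k + l) - 2 * L (k + l + 1) + L (k + l + 2))
      = (\<Sum>k<i. (L (Suc k + j) - L (k + j))) - (\<Sum>k<i. L (Suc k) - L k)"
    by (simp add: sum_subtractf)
  also have "\<dots> = (L (i + j) - L j) - (L i - L 0)"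
    using sum_lessThan_telescope [of "\<lambda>k. L (k + j)" i] sum_lessThan_telescope [of L i] by simp
  finally show ?thesis by simp
qed

text \<open>
  This is the sufficient half of the criterion that entrywise powers are positive semidefinite when
  the matrix of logarithms is conditionally positive definite. Taking differences of neighbouring
  indices removes the condition that the coordinates sum to 0, and for a Hankel matrix it
  leaves the Hankel matrix of the second differences, which is smaller by one.
\<close>
lemma nonneg_form_powr_hankel:
  fixes w c :: "nat \<Rightarrow> real" and v :: "nat \<Rightarrow> nat \<Rightarrow> real"
  assumes pos: "\<And>k. 0 < w k" and r: "0 < r" and c: "\<And>l. l < m \<Longrightarrow> 0 \<le> c l"
    and d: "\<And>k l. k < n \<Longrightarrow> l < n \<Longrightarrow>
              ln (w (k + l)) - 2 * ln (w (k + l + 1)) + ln (w (k + l + 2))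
                = (\<Sum>q<m. c q * v q k * v q l)"
  shows "nonneg_form (Suc n) (\<lambda>i j. w (i + j) powr r)"
  unfolding nonneg_form_def
proof
  fix x :: "nat \<Rightarrow> real"
  define V where "V q i = (\<Sum>k<i. v q k)" for q i
  \<comment> \<open>half of the constant goes to each index, so that the splitting is symmetric in i and j\<close>
  define b where "b i = ln (w i) - ln (w 0) / 2" for i
  have split: "w (i + j) powr r
      = exp (r * b i) * exp (r * b j) * exp (\<Sum>q<m. (r * c q) * V q i * V q j)"
    if "i < Suc n" "j < Suc n" for i j
  proof -
    have "ln (w (i + j)) - ln (w i) - ln (w j) + ln (w 0)
        = (\<Sum>k<i. \<Sum>l<j. \<Sum>q<m. c q * v q k * v q l)"
      unfolding sum_second_differences [of "\<lambda>k. ln (w k)", symmetric]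
      using that by (intro sum.cong refl d) auto
    also have "\<dots> = (\<Sum>k<i. \<Sum>q<m. \<Sum>l<j. c q * v q k * v q l)"
      by (intro sum.cong refl sum.swap)
    also have "\<dots> = (\<Sum>q<m. \<Sum>k<i. \<Sum>l<j. c q * v q k * v q l)"
      by (rule sum.swap)
    also have "\<dots> = (\<Sum>q<m. c q * V q i * V q j)"
      by (simp add: V_def sum_product sum_distrib_left mult_ac)
    finally have "ln (w (i + j)) = b i + b j + (\<Sum>q<m. c q * V q i * V q j)"
      by (simp add: b_def)
    hence "r * ln (w (i + j)) = r * b i + r * b j + (\<Sum>q<m. (r * c q) * V q i * V q j)"
      by (simp add: distrib_left sum_distrib_left mult_ac)
    thus ?thesis
      using pos [of "i + j"] by (simp add: powr_def exp_add)
  qed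
  have "(\<Sum>i<Suc n. \<Sum>j<Suc n. w (i + j) powr r * x i * x j)
      = (\<Sum>i<Suc n. \<Sum>j<Suc n. exp (\<Sum>q<m. (r * c q) * V q i * V q j)
           * (exp (r * b i) * x i) * (exp (r * b j) * x j))"
    by (intro sum.cong refl) (simp only: split lessThan_iff mult_ac)
  also have "\<dots> \<ge> 0"
    using nonneg_form_exp_gram [of m "\<lambda>q. r * c q" "Suc n" V] c r
    by (simp add: nonneg_form_def del: sum.lessThan_Suc)
  finally show "0 \<le> (\<Sum>i<Suc n. \<Sum>j<Suc n. w (i + j) powr r * x i * x j)" .
qed

text \<open>
  Gaussian elimination without square roots: with leading minors \<open>d 0\<close>, \<open>p\<close> and \<open>D\<close>, the pivots are
  \<open>d 0\<close>, \<open>p / d 0\<close> and \<open>D / p\<close>. The rows \<open>v\<close> are kept free of denominators, which is why the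
  weights are \<open>1 / d 0\<close>, \<open>1 / (d 0 * p)\<close> and \<open>D / p\<close>. The last minor may vanish.
\<close>
lemma hankel_3_gram:
  fixes d :: "nat \<Rightarrow> real"
  assumes d0: "0 < d 0" and p: "0 < d 0 * d 2 - (d 1)\<^sup>2"
    and det: "0 \<le> d 0 * (d 2 * d 4 - (d 3)\<^sup>2) - (d 1)\<^sup>2 * d 4
                    + 2 * (d 1 * d 2 * d 3) - d 2 ^ 3"
  shows "\<exists>(c :: nat \<Rightarrow> real) v. (\<forall>q<3. 0 \<le> c q) \<and>
           (\<forall>k<3. \<forall>l<3. d (k + l) = (\<Sum>q<3. c q * v q k * v q l))"
proof -
  define p where "p = d 0 * d 2 - (d 1)\<^sup>2"
  define s where "s = d 0 * d 3 - d 1 * d 2"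
  define D where "D = d 0 * (d 2 * d 4 - (d 3)\<^sup>2) - (d 1)\<^sup>2 * d 4
                        + 2 * (d 1 * d 2 * d 3) - d 2 ^ 3"
  define c where "c q = [1 / d 0, 1 / (d 0 * p), D / p] ! q" for q
  define v where "v q k = [[d 0, d 1, d 2], [0, p, s], [0, 0, 1]] ! q ! k" for q k
  have pos: "d 0 > 0" "p > 0" "D \<ge> 0"
    using assms by (auto simp: p_def D_def)
  have d2: "d 2 = (d 1)\<^sup>2 / d 0 + p / d 0"
    using pos by (simp add: p_def field_simps)
  have d3: "d 3 = d 1 * d 2 / d 0 + s / d 0"
    using pos by (simp add: s_def field_simps)
  \<comment> \<open>Sylvester's determinant identity for D, with the pivot d 0\<close>
  have det_eq: "d 0 * D = p * (d 0 * d 4 - (d 2)\<^sup>2) - s\<^sup>2"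
    unfolding D_def p_def s_def by (simp add: power2_eq_square power3_eq_cube algebra_simps)
  have "D / p = d 0 * D / (d 0 * p)"
    using pos by simp
  also have "\<dots> = (p * (d 0 * d 4 - (d 2)\<^sup>2) - s\<^sup>2) / (d 0 * p)"
    by (simp only: det_eq)
  also have "\<dots> = d 4 - (d 2)\<^sup>2 / d 0 - s\<^sup>2 / (d 0 * p)"
    using pos by (simp add: diff_divide_distrib)
  finally have d4: "d 4 = (d 2)\<^sup>2 / d 0 + s\<^sup>2 / (d 0 * p) + D / p"
    by simp
  have less3: "k < 3 \<longleftrightarrow> k = 0 \<or> k = 1 \<or> k = 2" for k :: nat by auto
  show ?thesis
  proof (intro exI conjI allI impI)
    show "0 \<le> c q" if "q < 3" for q
      using that pos by (auto simp: less3 c_def)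
    show "d (k + l) = (\<Sum>q<3. c q * v q k * v q l)" if "k < 3" "l < 3" for k l
    proof -
      have "(\<Sum>q<3. c q * v q k * v q l)
          = c 0 * v 0 k * v 0 l + c 1 * v 1 k * v 1 l + c 2 * v 2 k * v 2 l"
        by (simp add: eval_nat_numeral)
      also have "\<dots> = v 0 k * v 0 l / d 0 + v 1 k * v 1 l / (d 0 * p) + v 2 k * v 2 l * D / p"
        by (simp add: c_def)
      also have "\<dots> = d (k + l)"
        using that pos d2 d3 d4 unfolding less3
        by (elim disjE) (simp_all add: v_def power2_eq_square eval_nat_numeral)
      finally show ?thesis by simp
    qed
  qed
qed

section \<open>The first Bell numbers\<close>

text \<open>
  The recursion in terms of binary numerals: expanding numerals into iterated successors would do
  the same to the values up to 4140.
\<close>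
lemma Stirling_numeral:
  "Stirling (numeral a) (numeral b)
     = numeral b * Stirling (pred_numeral a) (numeral b) + Stirling (pred_numeral a) (pred_numeral b)"
  "Stirling (numeral a) (Suc 0) = Stirling (pred_numeral a) (Suc 0) + Stirling (pred_numeral a) 0"
  "Stirling (numeral a) 0 = 0"
  "Stirling (Suc 0) (numeral b) = Stirling 0 (pred_numeral b)"
  by (simp_all add: numeral_eq_Suc)

lemma bell_values:
  "bell 0 = 1" "bell (Suc 0) = 1" "bell 2 = 2" "bell 3 = 5" "bell 4 = 15"
  "bell 5 = 52" "bell 6 = 203" "bell 7 = 877" "bell 8 = 4140"
  by (simp_all add: bell_def atMost_nat_numeral atMost_Suc Stirling_numeral)

lemma bell_pos: "0 < bell n"
proof -
  have "0 < Stirling n n" by simp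
  also have "\<dots> \<le> bell n"
    unfolding bell_def by (rule member_le_sum) auto
  finally show ?thesis .
qed

section \<open>Size at most 4\<close>

text \<open>
  The variable \<open>y\<close> names the argument of the series \<open>ln x = 2 * artanh ((x - 1) / (x + 1))\<close>, so that
  it can be supplied as a reduced fraction.
\<close>
lemma ln_mem_interval:
  fixes x y lo hi :: real
  assumes "1 < x" and y: "(x - 1) / (x + 1) = y"
    and "lo \<le> (\<Sum>k<n. 2 * y ^ (2 * k + 1) / real (2 * k + 1))"
    and "(\<Sum>k<n. 2 * y ^ (2 * k + 1) / real (2 * k + 1))
           + 2 * (y ^ (2 * n + 1) / (1 - y\<^sup>2) / real (2 * n + 1)) \<le> hi"
  shows "ln x \<in> {lo..hi}"
  using ln_approx_bounds [of x n] assms unfolding y by fastforce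

text \<open>
  These are the second differences of \<open>ln (bell k)\<close> for \<open>k = 0, \<dots>, 4\<close>. Their 3 by 3 Hankel
  determinant is only about \<open>0.00031\<close>; with four digits the error stays below \<open>0.00004\<close>.
\<close>
lemma ln_ratio_bounds:
  "ln 2 \<in> {0.6931..0.6932::real}" "ln (5 / 4) \<in> {0.2231..0.2232::real}"
  "ln (6 / 5) \<in> {0.1823..0.1824::real}" "ln (52 / 45) \<in> {0.1445..0.1446::real}"
  "ln (3045 / 2704) \<in> {0.1187..0.1188::real}"
proof -
  note eval = lessThan_nat_numeral lessThan_Suc power_divide
  show "ln 2 \<in> {0.6931..0.6932::real}"
    by (rule ln_mem_interval [where y = "1 / 3" and n = 4]) (simp_all add: eval)
  show "ln (5 / 4) \<in> {0.2231..0.2232::real}"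
    by (rule ln_mem_interval [where y = "1 / 9" and n = 2]) (simp_all add: eval)
  show "ln (6 / 5) \<in> {0.1823..0.1824::real}"
    by (rule ln_mem_interval [where y = "1 / 11" and n = 2]) (simp_all add: eval)
  show "ln (52 / 45) \<in> {0.1445..0.1446::real}"
    by (rule ln_mem_interval [where y = "7 / 97" and n = 2]) (simp_all add: eval)
  show "ln (3045 / 2704) \<in> {0.1187..0.1188::real}"
    by (rule ln_mem_interval [where y = "341 / 5749" and n = 2]) (simp_all add: eval)
qed

text \<open>
  The interval bounds are inserted monomial by monomial, each in the direction that makes the minor
  smaller. The terms \<open>d 2 * d 4\<close> and \<open>(d 3)\<^sup>2\<close> stay together under the factor \<open>d 0\<close>: their difference
  is positive already for the bounds, so the product can be bounded factor by factor.
\<close>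
lemma bell_log_second_differences_gram:
  "\<exists>(c :: nat \<Rightarrow> real) v. (\<forall>q<3. 0 \<le> c q) \<and>
     (\<forall>k<3. \<forall>l<3.
        ln (real (bell (k + l))) - 2 * ln (real (bell (k + l + 1))) + ln (real (bell (k + l + 2)))
          = (\<Sum>q<3. c q * v q k * v q l))"
proof -
  define d where
    "d k = ln (real (bell k)) - 2 * ln (real (bell (k + 1))) + ln (real (bell (k + 2)))" for k
  have ratio: "d k = ln (real (bell k * bell (k + 2)) / real (bell (k + 1) ^ 2))" for k
    by (simp add: d_def ln_mult ln_div ln_realpow bell_pos)
  have d: "d 0 = ln 2" "d 1 = ln (5 / 4)" "d 2 = ln (6 / 5)" "d 3 = ln (52 / 45)"
    "d 4 = ln (3045 / 2704)"
    by (simp_all add: ratio bell_values numeral_2_eq_2 [symmetric])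
  note bounds = ln_ratio_bounds [folded d, unfolded atLeastAtMost_iff]
  have sq1: "(d 1)\<^sup>2 \<le> 0.2232\<^sup>2" and sq3: "(d 3)\<^sup>2 \<le> 0.1446\<^sup>2" and cube2: "d 2 ^ 3 \<le> 0.1824 ^ 3"
    using bounds by (auto intro!: power_mono)
  have "0.6931 * 0.1823 \<le> d 0 * d 2"
    using bounds by (intro mult_mono) auto
  hence p: "0 < d 0 * d 2 - (d 1)\<^sup>2"
    using sq1 by (simp add: power2_eq_square)
  have "0.1823 * 0.1187 \<le> d 2 * d 4"
    using bounds by (intro mult_mono) auto
  hence "0.6931 * (0.1823 * 0.1187 - 0.1446\<^sup>2) \<le> d 0 * (d 2 * d 4 - (d 3)\<^sup>2)"
    using bounds sq3 by (intro mult_mono) (auto simp: power2_eq_square)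
  moreover have "(d 1)\<^sup>2 * d 4 \<le> 0.2232\<^sup>2 * 0.1188"
    using bounds sq1 by (intro mult_mono) auto
  moreover have "0.2231 * 0.1823 * 0.1445 \<le> d 1 * d 2 * d 3"
    using bounds by (intro mult_mono mult_nonneg_nonneg) auto
  ultimately have det: "0 \<le> d 0 * (d 2 * d 4 - (d 3)\<^sup>2) - (d 1)\<^sup>2 * d 4
      + 2 * (d 1 * d 2 * d 3) - d 2 ^ 3"
    using cube2 by (simp add: power2_eq_square power3_eq_cube)
  have "0 < d 0" using bounds by simp
  from hankel_3_gram [OF this p det] show ?thesis
    unfolding d_def .
qed

section \<open>Size at least 5\<close>

text \<open>
  The value is about \<open>-0.0001\<close>; exponentiating avoids all approximation and leaves the comparison
  of two integers.
\<close>
lemma bell_log_sixth_difference_neg: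
  "ln 2 - 6 * ln 5 + 15 * ln 15 - 20 * ln 52 + 15 * ln 203 - 6 * ln 877 + ln 4140 < (0::real)"
proof -
  have "ln (2 * 15 ^ 15 * 203 ^ 15 * 4140) < ln (5 ^ 6 * 52 ^ 20 * 877 ^ 6 :: real)"
    by (subst ln_less_cancel_iff) simp_all
  moreover have "ln (2 * 15 ^ 15 * 203 ^ 15 * 4140 :: real)
      = ln 2 + 15 * ln 15 + 15 * ln 203 + ln 4140"
    by (simp only: ln_mult_pos ln_realpow zero_less_power zero_less_numeral mult_pos_pos)
  moreover have "ln (5 ^ 6 * 52 ^ 20 * 877 ^ 6 :: real) = 6 * ln 5 + 20 * ln 52 + 6 * ln 877"
    by (simp only: ln_mult_pos ln_realpow zero_less_power zero_less_numeral mult_pos_pos)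
  ultimately show ?thesis by linarith
qed

text \<open>
  Products of two coordinates of \<open>(0, -1, 3, -3, 1)\<close>, collected by the sum \<open>i + j\<close> of their indices,
  are the coefficients of \<open>t\<^sup>2 * (t - 1) ^ 6\<close>. Hence the form at this vector is the sixth difference
  at 2 of \<open>k \<mapsto> bell k powr r\<close>, called \<open>f r\<close> below. It vanishes at \<open>r = 0\<close>, where its derivative is
  the sixth difference of \<open>ln (bell k)\<close>.
\<close>
lemma not_nonneg_form_bell_5:
  "\<exists>r>0. \<not> nonneg_form 5 (\<lambda>i j. real (bell (i + j)) powr r)"
proof -
  define f :: "real \<Rightarrow> real" where
    "f r = 2 powr r - 6 * 5 powr r + 15 * 15 powr r - 20 * 52 powr r
             + 15 * 203 powr r - 6 * 877 powr r + 4140 powr r" for r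
  have "(f has_real_derivative
      ln 2 - 6 * ln 5 + 15 * ln 15 - 20 * ln 52 + 15 * ln 203 - 6 * ln 877 + ln 4140) (at 0)"
    unfolding f_def by (auto intro!: derivative_eq_intros)
  from DERIV_neg_dec_right [OF this bell_log_sixth_difference_neg]
  obtain e where e: "e > 0" "\<And>h. 0 < h \<Longrightarrow> h < e \<Longrightarrow> f h < f 0"
    by auto
  define r where "r = e / 2"
  have r: "r > 0" "f r < 0"
    using e(1) e(2) [of r] by (auto simp: r_def f_def)
  define x :: "nat \<Rightarrow> real" where "x i = [0, -1, 3, -3, 1] ! i" for i
  have x: "x 0 = 0" "x (Suc 0) = - 1" "x 2 = 3" "x 3 = - 3" "x 4 = 1"
    by (simp_all add: x_def)
  have lessThan_5: "{..<5} = {0, Suc 0, 2, 3, 4 :: nat}" by auto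
  have "(\<Sum>i<5. \<Sum>j<5. real (bell (i + j)) powr r * x i * x j) = f r"
    by (simp add: lessThan_5 bell_values x f_def numeral_2_eq_2 [symmetric])
  hence "\<not> nonneg_form 5 (\<lambda>i j. real (bell (i + j)) powr r)"
    using r unfolding nonneg_form_def not_all by (intro exI [of _ x]) simp
  thus ?thesis using r by blast
qed

theorem theorem3p6:
  fixes n :: nat
  assumes "n > 0"
  shows "infinitely_divisible (bell_matrix n) \<longleftrightarrow> n \<le> 4"
  unfolding infinitely_divisible_bell_matrix_iff
proof
  assume *: "\<forall>r>0. nonneg_form n (\<lambda>i j. real (bell (i + j)) powr r)"
  show "n \<le> 4"
  proof (rule ccontr)
    assume "\<not> n \<le> 4"
    hence "\<forall>r>0. nonneg_form 5 (\<lambda>i j. real (bell (i + j)) powr r)"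
      using * nonneg_form_mono [of n _ 5] by auto
    thus False using not_nonneg_form_bell_5 by blast
  qed
next
  assume n: "n \<le> 4"
  obtain c :: "nat \<Rightarrow> real" and v :: "nat \<Rightarrow> nat \<Rightarrow> real" where
    c: "\<forall>q<3. 0 \<le> c q" and
    v: "\<forall>k<3. \<forall>l<3.
      ln (real (bell (k + l))) - 2 * ln (real (bell (k + l + 1))) + ln (real (bell (k + l + 2)))
        = (\<Sum>q<3. c q * v q k * v q l)"
    using bell_log_second_differences_gram by (elim exE conjE)
  show "\<forall>r>0. nonneg_form n (\<lambda>i j. real (bell (i + j)) powr r)"
  proof (intro allI impI)
    fix r :: real
    assume "r > 0"
    hence "nonneg_form (Suc 3) (\<lambda>i j. real (bell (i + j)) powr r)"
      using c v
      by (intro nonneg_form_powr_hankel [where w = "\<lambda>k. real (bell k)" and m = 3 and c = c and v = v])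
        (simp_all add: bell_pos)
    thus "nonneg_form n (\<lambda>i j. real (bell (i + j)) powr r)"
      by (rule nonneg_form_mono) (use n in simp)
  qed
qed

end
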